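(* Let $\mathbb{A}$ be a finite non-empty set and let $x\in\mathbb{A}^{\mathbb{N}}$ be self-shuffling. Then for each positive integer $N$ there exists a positive integer $M$ such that every prefix $u$ of $x$ with $|u|\ge M$ has an Abelian border $v$ with $|u|/2\ge|v|\ge N$. Moreover, every prefix of $x$ longer than the shuffling delay of $x$ is Abelian bordered. In particular, $x$ begins in only a finite number of Abelian unbordered words.
   Context: For infinite words $y,z$, $\mathscr{S}(y,z)$ is the set of infinite words $w$ for which there are finite (possibly empty) words $U_i,V_i$, $i\ge0$, with $w=\prod_{i=0}^\infty U_iV_i$, $y=\prod_{i=0}^\infty U_i$, $z=\prod_{i=0}^\infty V_i$. A word $x$ is self-shuffling if $x\in\mathscr{S}(x,x)$. Two finite words are Abelian equivalent if each letter occurs the same number of times in both. A finite word $u$ has an Abelian border of length $n$, $0<n<|u|$, if its prefix of length $n$ is Abelian equivalent to its suffix of length $n$; it is Abelian bordered if it has an Abelian border of some length and Abelian unbordered otherwise. For a finite prefix $p$ of an infinite word $y$, $p^{-1}y$ denotes the infinite word $y'$ with $y=py'$. The shuffling delay of a self-shuffling word $x$ is the length of the shortest non-empty prefix $u$ of $x$ such that the letter $a$ following the prefix $u$ in $x$ is the first letter of $x$ and $(ua)^{-1}x\in\mathscr{S}(u^{-1}x,a^{-1}x)$. *)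

theory Defs
  imports Main "HOL-Library.Omega_Words_Fun"
begin

definition begins_with :: "'a word \<Rightarrow> 'a list \<Rightarrow> bool" where
  "begins_with x u \<longleftrightarrow> (\<exists>y. x = u \<frown> y)"

text \<open>
  The left quotient of \<open>y\<close> by \<open>p\<close> is only meaningful if \<open>p\<close> is a prefix of \<open>y\<close>;
  it is the unique \<open>y'\<close> with \<open>y = p \<frown> y'\<close>.
\<close>

definition left_quotient :: "'a list \<Rightarrow> 'a word \<Rightarrow> 'a word" where
  "left_quotient p y = suffix (length p) y"

lemma left_quotient_iff:
  assumes "begins_with y p"
  shows "left_quotient p y = y' \<longleftrightarrow> y = p \<frown> y'"
  using assms by (auto simp: begins_with_def left_quotient_def)

text \<open>
  \<open>is_product W w\<close> says that the infinite word \<open>w\<close> is \<open>W 0 W 1 W 2 \<dots>\<close>. The factors may be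
  empty, but infinitely many of them are not, since otherwise the product would be a finite word.
\<close>

definition is_product :: "(nat \<Rightarrow> 'a list) \<Rightarrow> 'a word \<Rightarrow> bool" where
  "is_product W w \<longleftrightarrow>
     infinite {i. W i \<noteq> []} \<and> (\<forall>n. begins_with w (concat (map W [0..<n])))"

definition shuffle_set :: "'a word \<Rightarrow> 'a word \<Rightarrow> 'a word set" where
  "shuffle_set y z =
     {w. \<exists>U V. is_product (\<lambda>i. U i @ V i) w \<and> is_product U y \<and> is_product V z}"

definition self_shuffling :: "'a word \<Rightarrow> bool" where
  "self_shuffling x \<longleftrightarrow> x \<in> shuffle_set x x"

definition abelian_equivalent :: "'a list \<Rightarrow> 'a list \<Rightarrow> bool" where
  "abelian_equivalent u v \<longleftrightarrow> (\<forall>a. count_list u a = count_list v a)"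

definition has_abelian_border :: "'a list \<Rightarrow> nat \<Rightarrow> bool" where
  "has_abelian_border u n \<longleftrightarrow>
     0 < n \<and> n < length u \<and> abelian_equivalent (take n u) (drop (length u - n) u)"

definition abelian_bordered :: "'a list \<Rightarrow> bool" where
  "abelian_bordered u \<longleftrightarrow> (\<exists>n. has_abelian_border u n)"

abbreviation abelian_unbordered :: "'a list \<Rightarrow> bool" where
  "abelian_unbordered u \<equiv> \<not> abelian_bordered u"

text \<open>
  A self-shuffling word always has a prefix as in the following definition (take the first block
  up to the point where the other copy of the word contributes its first letter), so that the
  minimum is attained. For other words the value may be unspecified.
\<close>

definition shuffling_delay :: "'a word \<Rightarrow> nat" where
  "shuffling_delay x =
     (LEAST n. \<exists>u a. length u = n \<and> u \<noteq> [] \<and> begins_with x (u @ [a]) \<and> a = x 0 \<and>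
        left_quotient (u @ [a]) x \<in> shuffle_set (left_quotient u x) (left_quotient [a] x))"

end

theory Submission
  imports Defs
begin

text \<open>
  Read a self-shuffling word \<open>x\<close> from left to right, attributing each letter to one of the two
  copies of \<open>x\<close> that are shuffled. If \<open>p\<close> of the first \<open>n\<close> letters come from the first copy and
  \<open>q = n - p\<close> from the second, then the prefix of length \<open>n\<close> has the same letters, with
  multiplicity, as the prefixes of lengths \<open>p\<close> and \<open>q\<close> together. For \<open>q \<le> p\<close>, removing the
  prefix of length \<open>p\<close> leaves a suffix of length \<open>q\<close> that is Abelian equivalent to the
  prefix of length \<open>q\<close>. So \<open>min p q\<close> is the length of an Abelian border as soon as
  both copies have contributed, and it is at most \<open>n / 2\<close> (\<open>has_abelian_border_min\<close>).

  Both \<open>p\<close> and \<open>q\<close> tend to infinity with \<open>n\<close> (\<open>shuffle_counts\<close>), which gives long borders.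
  Beyond the shuffling delay both copies have contributed a letter
  (\<open>abelian_bordered_beyond_delay_prefix\<close>), provided that the minimum that defines the delay is
  attained (\<open>shuffling_delay_attained\<close>). Every prefix longer than the delay is therefore bordered,
  and only finitely many prefixes remain.
\<close>

section \<open>Prefixes and products of infinite words\<close>

lemma begins_with_iff: "begins_with x u \<longleftrightarrow> u = prefix (length u) x"
proof
  assume "begins_with x u"
  then show "u = prefix (length u) x"
    by (auto simp: begins_with_def)
next
  assume "u = prefix (length u) x"
  then have "x = u \<frown> suffix (length u) x"
    by (metis prefix_suffix)
  then show "begins_with x u"
    unfolding begins_with_def by blast
qed

lemma begins_with_append:
  "begins_with x (u @ v) \<longleftrightarrow> begins_with x u \<and> begins_with (suffix (length u) x) v"
proof
  assume "begins_with x (u @ v)"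
  then obtain y where "x = u \<frown> (v \<frown> y)"
    unfolding begins_with_def conc_conc by blast
  moreover from this have "suffix (length u) x = v \<frown> y"
    by simp
  ultimately show "begins_with x u \<and> begins_with (suffix (length u) x) v"
    unfolding begins_with_def by blast
next
  assume "begins_with x u \<and> begins_with (suffix (length u) x) v"
  then obtain y z where "x = u \<frown> y" "suffix (length u) x = v \<frown> z"
    unfolding begins_with_def by blast
  then have "x = (u @ v) \<frown> z"
    by simp
  then show "begins_with x (u @ v)"
    unfolding begins_with_def by blast
qed

lemma prefix_add: "prefix (m + n) x = prefix m x @ prefix n (suffix m x)"
  by (rule nth_equalityI) (auto simp: nth_append)

lemma is_product_begins_with:
  "is_product W w \<Longrightarrow> begins_with w (concat (map W [0..<n]))"
  by (simp add: is_product_def)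

text \<open>
  A product can be cut at any point. What remains of the factors with index at most \<open>m\<close> is merged
  into the first factor of the rest, and the later factors are kept.
\<close>

lemma is_product_tail:
  assumes W: "is_product W w" and lr: "l @ r = concat (map W [0..<Suc m])"
  shows "is_product (case_nat r (\<lambda>i. W (Suc (i + m)))) (suffix (length l) w)"
proof -
  let ?W = "case_nat r (\<lambda>i. W (Suc (i + m)))"
  have conc: "l @ concat (map ?W [0..<Suc n]) = concat (map W [0..<Suc (n + m)])" for n
    by (induction n) (use lr in auto)
  have "begins_with w (l @ concat (map ?W [0..<Suc n]))" for n
    unfolding conc by (rule is_product_begins_with[OF W])
  then have Suc: "begins_with (suffix (length l) w) (concat (map ?W [0..<Suc n]))" for n
    unfolding begins_with_append by blast
  have "begins_with (suffix (length l) w) (concat (map ?W [0..<n]))" for n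
    using Suc[of n] by (simp add: begins_with_append)
  moreover have "infinite {i. ?W i \<noteq> []}"
    unfolding infinite_nat_iff_unbounded
  proof
    fix n
    have "infinite {i. W i \<noteq> []}"
      using W by (simp add: is_product_def)
    then obtain i where "i > n + Suc m" "W i \<noteq> []"
      unfolding infinite_nat_iff_unbounded by blast
    moreover define j where "j = i - Suc m"
    ultimately have "n < Suc j" "Suc (j + m) = i"
      by auto
    with \<open>W i \<noteq> []\<close> have "?W (Suc j) \<noteq> [] \<and> n < Suc j"
      by simp
    then show "\<exists>i>n. i \<in> {i. ?W i \<noteq> []}"
      by blast
  qed
  ultimately show ?thesis
    by (simp add: is_product_def)
qed

lemma length_concat_map_upt_mono:
  "m \<le> n \<Longrightarrow> length (concat (map W [0..<m])) \<le> length (concat (map W [0..<n]))"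
  by (induction n rule: dec_induct) auto

lemma is_product_length_unbounded:
  assumes "is_product W w"
  shows "\<exists>m. N \<le> length (concat (map W [0..<m]))"
proof (induction N)
  case (Suc N)
  then obtain m where m: "N \<le> length (concat (map W [0..<m]))"
    by blast
  obtain i where i: "i > m" "W i \<noteq> []"
    using assms unfolding is_product_def infinite_nat_iff_unbounded by blast
  then have "Suc N \<le> length (concat (map W [0..<Suc i]))"
    using m length_concat_map_upt_mono[of m i W] by (cases "W i") auto
  then show ?case
    by blast
qed auto


section \<open>How the letters of a shuffle are distributed over the two words\<close>

lemma count_concat_interleave:
  "count_list (concat (map (\<lambda>i. U i @ V i) [0..<n])) a =
     count_list (concat (map U [0..<n])) a + count_list (concat (map V [0..<n])) a"
  by (induction n) auto

lemma length_concat_interleave: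
  "length (concat (map (\<lambda>i. U i @ V i) [0..<n])) =
     length (concat (map U [0..<n])) + length (concat (map V [0..<n]))"
  by (induction n) auto

text \<open>
  If the prefix of \<open>w\<close> ends inside the block \<open>U k @ V k\<close>, the letters taken from \<open>y\<close> and
  from \<open>z\<close> are the first \<open>k\<close> factors \<open>U i\<close> and \<open>V i\<close> and the parts of \<open>U k\<close> and \<open>V k\<close> inside
  the prefix. The bounds on \<open>p\<close> and \<open>q\<close> hold since \<open>k \<ge> K\<close>.
\<close>

lemma interleave_counts:
  assumes UV: "is_product (\<lambda>i. U i @ V i) w" and U: "is_product U y" and V: "is_product V z"
    and n: "length (concat (map (\<lambda>i. U i @ V i) [0..<K])) \<le> n"
  shows "\<exists>p q. p + q = n \<and>
      length (concat (map U [0..<K])) \<le> p \<and> length (concat (map V [0..<K])) \<le> q \<and>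
      (\<forall>a. count_list (prefix n w) a = count_list (prefix p y) a + count_list (prefix q z) a)"
proof -
  let ?L = "\<lambda>W k. length (concat (map W [0..<k]))"
  let ?W = "\<lambda>i. U i @ V i"
  obtain k0 where "Suc n \<le> ?L ?W k0"
    using is_product_length_unbounded[OF UV] by blast
  then have "\<exists>k. n < ?L ?W (Suc k)"
    using length_concat_map_upt_mono[of k0 "Suc k0" ?W] by (intro exI[of _ k0]) linarith
  then obtain k where k: "n < ?L ?W (Suc k)" and least: "\<And>j. j < k \<Longrightarrow> ?L ?W (Suc j) \<le> n"
    unfolding exists_least_iff[of "\<lambda>k. n < ?L ?W (Suc k)"] not_less by blast
  have lower: "?L ?W k \<le> n"
    using least[of "k - 1"] by (cases k) auto
  have Kk: "K \<le> k"
    using n k length_concat_map_upt_mono[of "Suc k" K ?W] by linarith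
  define r where "r = n - ?L ?W k"
  define p where "p = ?L U k + length (take r (U k))"
  define q where "q = ?L V k + length (take (r - length (U k)) (V k))"
  have pre: "v = prefix (length v) x" if "is_product W x" "concat (map W [0..<Suc k]) = v @ v'"
    for W x v v'
    using is_product_begins_with[OF that(1), of "Suc k"] unfolding that(2)
    by (simp add: begins_with_append begins_with_iff[symmetric])
  have y: "prefix p y = concat (map U [0..<k]) @ take r (U k)"
    using pre[OF U, of "concat (map U [0..<k]) @ take r (U k)" "drop r (U k)"]
    by (simp add: p_def)
  have z: "prefix q z = concat (map V [0..<k]) @ take (r - length (U k)) (V k)"
    using pre[OF V, of "concat (map V [0..<k]) @ take (r - length (U k)) (V k)"
        "drop (r - length (U k)) (V k)"]
    by (simp add: q_def)
  have pq: "p + q = n"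
    using k lower unfolding p_def q_def r_def by (auto simp: length_concat_interleave)
  have w: "prefix n w = concat (map ?W [0..<k]) @ take r (?W k)"
  proof -
    have "length (concat (map ?W [0..<k]) @ take r (?W k)) = n"
      using k lower by (auto simp: r_def length_concat_interleave)
    then show ?thesis
      using pre[OF UV, of "concat (map ?W [0..<k]) @ take r (?W k)" "drop r (?W k)"]
      by (simp del: take_append drop_append)
  qed
  have "count_list (prefix n w) a = count_list (prefix p y) a + count_list (prefix q z) a" for a
    unfolding w y z by (simp add: count_concat_interleave)
  moreover have "?L U K \<le> p" "?L V K \<le> q"
    using length_concat_map_upt_mono[OF Kk, of U] length_concat_map_upt_mono[OF Kk, of V]
    by (simp_all add: p_def q_def)
  ultimately show ?thesis
    using pq by blast
qed

lemma shuffle_counts: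
  assumes "w \<in> shuffle_set y z"
  shows "\<exists>M. \<forall>n\<ge>M. \<exists>p q. p + q = n \<and> N \<le> p \<and> N \<le> q \<and>
      (\<forall>a. count_list (prefix n w) a = count_list (prefix p y) a + count_list (prefix q z) a)"
proof -
  obtain U V where UV: "is_product (\<lambda>i. U i @ V i) w" and U: "is_product U y" and V: "is_product V z"
    using assms by (auto simp: shuffle_set_def)
  obtain k l where "N \<le> length (concat (map U [0..<k]))" "N \<le> length (concat (map V [0..<l]))"
    using is_product_length_unbounded[OF U] is_product_length_unbounded[OF V] by blast
  then have "N \<le> length (concat (map U [0..<max k l]))" "N \<le> length (concat (map V [0..<max k l]))"
    using length_concat_map_upt_mono[of k "max k l" U] length_concat_map_upt_mono[of l "max k l" V]
    by linarith+
  then show ?thesis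
    using interleave_counts[OF UV U V, of "max k l"] le_trans by meson
qed

lemma shuffle_counts_every_length:
  assumes "w \<in> shuffle_set y z"
  shows "\<exists>p q. p + q = n \<and>
      (\<forall>a. count_list (prefix n w) a = count_list (prefix p y) a + count_list (prefix q z) a)"
proof -
  obtain U V where "is_product (\<lambda>i. U i @ V i) w" "is_product U y" "is_product V z"
    using assms by (auto simp: shuffle_set_def)
  from interleave_counts[OF this, of 0 n] show ?thesis
    by auto
qed

text \<open>
  By symmetry let \<open>q \<le> p\<close>. The first \<open>p\<close> letters of the prefix account for one summand,
  so the remaining \<open>q\<close> letters account for the other one, the prefix of length \<open>q\<close>.
\<close>

lemma has_abelian_border_min:
  assumes "0 < p" "0 < q"
    and "\<And>a. count_list (prefix (p + q) x) a = count_list (prefix p x) a + count_list (prefix q x) a"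
  shows "has_abelian_border (prefix (p + q) x) (min p q)"
  using assms
proof (induction p q rule: linorder_wlog)
  case (le q p)
  have "prefix (p + q) x = prefix q x @ prefix p (suffix q x)"
    by (simp add: prefix_add add.commute[of p q])
  then have take: "take q (prefix (p + q) x) = prefix q x"
    by simp
  have drop: "drop p (prefix (p + q) x) = prefix q (suffix p x)"
    by (simp add: prefix_add)
  have "count_list (prefix q (suffix p x)) a = count_list (prefix q x) a" for a
    using le(4)[of a] by (simp add: prefix_add add.commute[of q p])
  then show ?case
    using le take drop
    by (simp add: has_abelian_border_def abelian_equivalent_def add.commute[of q p])
next
  case (sym p q)
  have "has_abelian_border (prefix (q + p) x) (min q p)"
    by (rule sym.IH) (use sym.prems in \<open>simp_all add: add.commute\<close>)
  then show ?case
    by (simp add: add.commute min.commute)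
qed


section \<open>The shuffling delay\<close>

text \<open>
  The two copies are interchangeable: an empty factor in front shifts the blocks
  \<open>U 0 V 0 U 1 V 1 \<dots>\<close> to \<open>[] U 0 V 0 U 1 \<dots>\<close>.
\<close>

lemma interleave_swap:
  assumes UV: "is_product (\<lambda>i. U i @ V i) w" and U: "is_product U y" and V: "is_product V z"
  shows "is_product (\<lambda>i. case_nat [] V i @ U i) w" "is_product (case_nat [] V) z"
proof -
  have infV: "infinite {i. case_nat [] V i \<noteq> []}"
  proof -
    have "infinite (Suc ` {i. V i \<noteq> []})"
      using V by (simp add: is_product_def finite_image_iff)
    then show ?thesis
      by (rule contrapos_nn) (erule finite_subset[rotated], auto)
  qed
  have concV: "concat (map (case_nat [] V) [0..<Suc n]) = concat (map V [0..<n])" for n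
    by (induction n) auto
  have "begins_with z (concat (map (case_nat [] V) [0..<n]))" for n
    using is_product_begins_with[OF V, of "n - 1"] concV[of "n - 1"]
    by (cases n) (auto simp: begins_with_def)
  then show "is_product (case_nat [] V) z"
    using infV by (simp add: is_product_def)
  let ?W = "\<lambda>i. case_nat [] V i @ U i"
  have conc: "concat (map (\<lambda>i. U i @ V i) [0..<n]) @ U n = concat (map ?W [0..<Suc n])" for n
    by (induction n) auto
  have "begins_with w (concat (map (\<lambda>i. U i @ V i) [0..<n]) @ U n)" for n
    using is_product_begins_with[OF UV, of "Suc n"] by (auto simp: begins_with_append)
  then have "begins_with w (concat (map ?W [0..<Suc n]))" for n
    unfolding conc .
  then have "begins_with w (concat (map ?W [0..<n]))" for n
    by (cases n) (auto simp: begins_with_def)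
  moreover have "infinite {i. ?W i \<noteq> []}"
    using infV by (rule contrapos_nn) (erule finite_subset[rotated], auto)
  ultimately show "is_product ?W w"
    by (simp add: is_product_def)
qed

text \<open>
  The words \<open>u\<close> whose minimal length is the shuffling delay of \<open>x\<close>.
\<close>

definition delay_prefix :: "'a word \<Rightarrow> 'a list \<Rightarrow> bool" where
  "delay_prefix x u \<longleftrightarrow> u \<noteq> [] \<and> begins_with x (u @ [x 0]) \<and>
     left_quotient (u @ [x 0]) x \<in> shuffle_set (left_quotient u x) (left_quotient [x 0] x)"

text \<open>
  The copy that is factored by \<open>V\<close> contributes its first letter at the beginning of the
  factor \<open>V k\<close>. Everything before comes from the other copy, so it can serve as \<open>u\<close>.
\<close>

lemma delay_prefixI:
  assumes UV: "is_product (\<lambda>i. U i @ V i) x" and U: "is_product U x" and V: "is_product V x"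
    and k: "V k \<noteq> []" "\<And>i. i < k \<Longrightarrow> V i = []"
    and i: "i \<le> k" "U i \<noteq> []"
  shows "delay_prefix x (concat (map U [0..<Suc k]))"
proof -
  let ?u = "concat (map U [0..<Suc k])"
  have Vk: "concat (map V [0..<Suc k]) = V k"
    using k(2) by auto
  have V0: "V k = x 0 # tl (V k)"
  proof -
    have "begins_with x (V k)"
      using is_product_begins_with[OF V, of "Suc k"] unfolding Vk .
    then show ?thesis
      using k(1) by (cases "V k") (auto simp: begins_with_def)
  qed
  have "concat (map (\<lambda>i. U i @ V i) [0..<k]) = concat (map U [0..<k])"
    using k(2) by (intro arg_cong[of _ _ concat] map_cong) auto
  then have W: "(?u @ [x 0]) @ tl (V k) = concat (map (\<lambda>i. U i @ V i) [0..<Suc k])"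
    using V0 by simp
  have "?u \<noteq> []"
    using i by (auto simp del: upt_Suc)
  moreover have "begins_with x (?u @ [x 0])"
    using is_product_begins_with[OF UV, of "Suc k"] unfolding W[symmetric]
    by (metis begins_with_append)
  moreover have "left_quotient (?u @ [x 0]) x \<in>
      shuffle_set (left_quotient ?u x) (left_quotient [x 0] x)"
  proof -
    let ?U = "case_nat [] (\<lambda>i. U (Suc (i + k)))"
    let ?V = "case_nat (tl (V k)) (\<lambda>i. V (Suc (i + k)))"
    have "is_product ?U (left_quotient ?u x)"
      unfolding left_quotient_def by (rule is_product_tail[OF U]) simp
    moreover have "is_product ?V (left_quotient [x 0] x)"
      unfolding left_quotient_def by (rule is_product_tail[OF V]) (use Vk V0 in simp)
    moreover have "is_product (\<lambda>i. ?U i @ ?V i) (left_quotient (?u @ [x 0]) x)"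
    proof -
      have "(\<lambda>i. ?U i @ ?V i) = case_nat (tl (V k)) (\<lambda>i. U (Suc (i + k)) @ V (Suc (i + k)))"
        by (auto split: nat.split)
      then show ?thesis
        unfolding left_quotient_def using is_product_tail[OF UV W] by simp
    qed
    ultimately show ?thesis
      unfolding shuffle_set_def by blast
  qed
  ultimately show ?thesis
    by (simp add: delay_prefix_def)
qed

text \<open>
  Let \<open>V k\<close> be the first nonempty \<open>V\<close>-factor. If a nonempty \<open>U\<close>-factor comes before it,
  \<open>U\<close> is the copy that starts. Otherwise \<open>V\<close> starts, and swapping the copies leads back to
  the first case.
\<close>

lemma delay_prefix_exists:
  assumes "self_shuffling x"
  shows "\<exists>u. delay_prefix x u"
proof -
  obtain U V where UV: "is_product (\<lambda>i. U i @ V i) x" and U: "is_product U x" and V: "is_product V x"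
    using assms by (auto simp: self_shuffling_def shuffle_set_def)
  have first: "\<exists>k. W k \<noteq> [] \<and> (\<forall>i<k. W i = [])" if "is_product W x" for W
  proof -
    have "\<exists>k. W k \<noteq> []"
      using that not_finite_existsD unfolding is_product_def by auto
    then show ?thesis
      using exists_least_iff[of "\<lambda>k. W k \<noteq> []"] by auto
  qed
  obtain k where k: "V k \<noteq> []" "\<And>i. i < k \<Longrightarrow> V i = []"
    using first[OF V] by blast
  obtain j where j: "U j \<noteq> []" "\<And>i. i < j \<Longrightarrow> U i = []"
    using first[OF U] by blast
  show ?thesis
  proof (cases "j \<le> k")
    case True
    from delay_prefixI[OF UV U V k this j(1)] show ?thesis
      by blast
  next
    case False
    then have "Suc k \<le> j" "case_nat [] V (Suc k) \<noteq> []"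
      using k by auto
    from delay_prefixI[OF interleave_swap(1)[OF UV U V] interleave_swap(2)[OF UV U V] U j this]
    show ?thesis
      by blast
  qed
qed

lemma shuffling_delay_attained:
  assumes "self_shuffling x"
  obtains u where "delay_prefix x u" "length u = shuffling_delay x"
proof -
  have delay: "shuffling_delay x = (LEAST n. \<exists>u. length u = n \<and> delay_prefix x u)"
    unfolding shuffling_delay_def delay_prefix_def by (intro arg_cong[of _ _ Least] ext) auto
  have "\<exists>n u. length u = n \<and> delay_prefix x u"
    using delay_prefix_exists[OF assms] by blast
  from LeastI_ex[OF this] show ?thesis
    unfolding delay[symmetric] using that by blast
qed

text \<open>
  After the prefix \<open>u\<close> of the first copy and the first letter of the second, what remains of \<open>x\<close>
  is a shuffle of what remains of the two copies. So the copies have contributed \<open>length u + p > 0\<close>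
  and \<open>1 + q > 0\<close> letters.
\<close>

lemma abelian_bordered_beyond_delay_prefix:
  assumes u: "delay_prefix x u" and n: "length u < n"
  shows "abelian_bordered (prefix n x)"
proof -
  let ?d = "length u"
  define m where "m = n - Suc ?d"
  have S: "suffix (?d + 1) x \<in> shuffle_set (suffix ?d x) (suffix 1 x)"
    using u by (simp add: delay_prefix_def left_quotient_def)
  from shuffle_counts_every_length[OF this, of m] obtain p q where m: "p + q = m"
    and count: "\<And>a. count_list (prefix m (suffix (?d + 1) x)) a =
      count_list (prefix p (suffix ?d x)) a + count_list (prefix q (suffix 1 x)) a"
    by blast
  have n_eq: "n = (?d + p) + (1 + q)" "n = (?d + 1) + m"
    using n m by (auto simp: m_def)
  have ua: "prefix (?d + 1) x = prefix ?d x @ [x 0]"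
    using u by (metis begins_with_iff begins_with_append delay_prefix_def length_append_singleton
        Suc_eq_plus1)
  have "count_list (prefix n x) a = count_list (prefix (?d + p) x) a + count_list (prefix (1 + q) x) a"
    for a
  proof -
    have "count_list (prefix n x) a =
        count_list (prefix (?d + 1) x) a + count_list (prefix m (suffix (?d + 1) x)) a"
      unfolding n_eq(2) prefix_add by simp
    also have "\<dots> = count_list (prefix ?d x) a + count_list (prefix 1 x) a
        + count_list (prefix p (suffix ?d x)) a + count_list (prefix q (suffix 1 x)) a"
      unfolding ua count by simp
    also have "\<dots> = count_list (prefix (?d + p) x) a + count_list (prefix (1 + q) x) a"
      unfolding prefix_add by simp
    finally show ?thesis .
  qed
  then have "has_abelian_border (prefix n x) (min (?d + p) (1 + q))"
    unfolding n_eq(1) using u by (intro has_abelian_border_min) (auto simp: delay_prefix_def)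
  then show ?thesis
    unfolding abelian_bordered_def by blast
qed


section \<open>Abelian borders of prefixes of self-shuffling words\<close>

theorem proposition2p8:
  fixes A :: "'a set" and x :: "'a word"
  assumes "finite A" and "A \<noteq> {}" and "range x \<subseteq> A"
    and "self_shuffling x"
  shows "(\<forall>N>0. \<exists>M>0. \<forall>u. begins_with x u \<and> length u \<ge> M \<longrightarrow>
            (\<exists>n. has_abelian_border u n \<and> 2 * n \<le> length u \<and> n \<ge> N))
       \<and> (\<forall>u. begins_with x u \<and> length u > shuffling_delay x \<longrightarrow> abelian_bordered u)
       \<and> finite {u. begins_with x u \<and> abelian_unbordered u}"
proof (intro conjI)
  show "\<forall>N>0. \<exists>M>0. \<forall>u. begins_with x u \<and> length u \<ge> M \<longrightarrow>
            (\<exists>n. has_abelian_border u n \<and> 2 * n \<le> length u \<and> n \<ge> N)"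
  proof (intro allI impI)
    fix N :: nat
    assume N: "N > 0"
    obtain M where M: "\<And>n. n \<ge> M \<Longrightarrow> \<exists>p q. p + q = n \<and> N \<le> p \<and> N \<le> q \<and>
      (\<forall>a. count_list (prefix n x) a = count_list (prefix p x) a + count_list (prefix q x) a)"
      using shuffle_counts[of x x x N] \<open>self_shuffling x\<close> unfolding self_shuffling_def by blast
    have "\<exists>n. has_abelian_border u n \<and> 2 * n \<le> length u \<and> n \<ge> N"
      if u: "begins_with x u" "length u \<ge> Suc M" for u
    proof -
      obtain p q where pq: "p + q = length u" "N \<le> p" "N \<le> q"
        and count: "\<And>a. count_list (prefix (length u) x) a =
          count_list (prefix p x) a + count_list (prefix q x) a"
        using M[of "length u"] u(2) by auto
      have "has_abelian_border (prefix (p + q) x) (min p q)"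
        using N pq count by (intro has_abelian_border_min) auto
      moreover have "prefix (p + q) x = u"
        using u(1) pq(1) begins_with_iff by metis
      ultimately show ?thesis
        using pq by (intro exI[of _ "min p q"]) auto
    qed
    then show "\<exists>M>0. \<forall>u. begins_with x u \<and> length u \<ge> M \<longrightarrow>
            (\<exists>n. has_abelian_border u n \<and> 2 * n \<le> length u \<and> n \<ge> N)"
      by (intro exI[of _ "Suc M"]) auto
  qed
next
  obtain v where v: "delay_prefix x v" "length v = shuffling_delay x"
    using shuffling_delay_attained[OF \<open>self_shuffling x\<close>] .
  show delay: "\<forall>u. begins_with x u \<and> length u > shuffling_delay x \<longrightarrow> abelian_bordered u"
    using abelian_bordered_beyond_delay_prefix[OF v(1)] v(2) begins_with_iff by metis
  have "{u. begins_with x u \<and> abelian_unbordered u} \<subseteq> (\<lambda>n. prefix n x) ` {..shuffling_delay x}"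
    using delay begins_with_iff[of x] by (fastforce simp: image_iff not_less[symmetric])
  then show "finite {u. begins_with x u \<and> abelian_unbordered u}"
    by (rule finite_subset) simp
qed

end
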